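(* Let $M=(m_{i,j})$ be an $n\times n$ optimal binary matrix ($1\le i,j\le n$). Then each of the following matrices is also optimal: (i) $M_\pi=(m_{\pi(i),j})$ for any permutation $\pi$ of $\{1,\dots,n\}$; (ii) $M_r=(m_{i,n-j+1})$; (iii) $\overline{M}=(\overline{m}_{i,j})$, where $\overline{m}_{i,j}=1-m_{i,j}$.
   Context: Biker–hiker model: $n$ travellers $t_1,\dots,t_n$; posts $P_0,\dots,P_n$ at unit spacing; stage $s_j$ is the leg from $P_{j-1}$ to $P_j$. All start at $P_0$ at time $0$, walk at common speed $w$, cycle at common speed $v>w$, mode changes take no time. The $n\times n$ binary matrix $M=(m_{i,j})$ prescribes that $t_i$ cycles $s_j$ iff $m_{i,j}=1$. $M$ is $k$-uniform if every row and every column has exactly $k$ ones. Bicycles start at $P_0$, move only when ridden by one rider, and a traveller due to cycle $s_j$ must take a bicycle present at $P_{j-1}$ when he arrives there. $M$ is optimal if it is $k$-uniform for some $k$ and, with $k$ bicycles, the scheme can be executed with no traveller ever having to wait for a bicycle. *)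

theory Defs
  imports Complex_Main "HOL-Combinatorics.Permutations"
begin

text \<open>
  An \<open>n \<times> n\<close> matrix is a function on indices; only the entries with row index (traveller)
  and column index (stage) in \<open>{1..n}\<close> are meaningful. Posts are numbered \<open>0..n\<close>, and stage
  \<open>Suc j\<close> leads from post \<open>j\<close> to post \<open>Suc j\<close>.
\<close>

definition binary_matrix :: "nat \<Rightarrow> (nat \<Rightarrow> nat \<Rightarrow> int) \<Rightarrow> bool" where
  "binary_matrix n M \<longleftrightarrow> (\<forall>i\<in>{1..n}. \<forall>j\<in>{1..n}. M i j \<in> {0, 1})"

definition uniform_matrix :: "nat \<Rightarrow> nat \<Rightarrow> (nat \<Rightarrow> nat \<Rightarrow> int) \<Rightarrow> bool" where
  "uniform_matrix n k M \<longleftrightarrow>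
     binary_matrix n M \<and>
     (\<forall>i\<in>{1..n}. card {j\<in>{1..n}. M i j = 1} = k) \<and>
     (\<forall>j\<in>{1..n}. card {i\<in>{1..n}. M i j = 1} = k)"

text \<open>
  The time at which traveller \<open>i\<close> reaches post \<open>j\<close> if he never waits: he spends \<open>1 / v\<close> on each
  (unit length) stage that he cycles and \<open>1 / w\<close> on each stage that he walks.
\<close>

definition arrival :: "real \<Rightarrow> real \<Rightarrow> (nat \<Rightarrow> nat \<Rightarrow> int) \<Rightarrow> nat \<Rightarrow> nat \<Rightarrow> real" where
  "arrival v w M i j = (\<Sum>l = 1..j. if M i l = 1 then 1 / v else 1 / w)"

text \<open>
  A plan \<open>ride\<close> names the bicycle \<open>ride i j\<close> that traveller \<open>i\<close> uses on a stage \<open>j\<close> that he cycles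
  (its value is irrelevant if he walks stage \<open>j\<close>). Bicycle \<open>b\<close> is present at post \<open>j\<close> at time \<open>t\<close>
  if it started there (\<open>j = 0\<close>) or has been ridden there by time \<open>t\<close>, and nobody has ridden it
  onwards strictly before \<open>t\<close>. As changing mode takes no time, a bicycle brought in at time \<open>t\<close>
  can be taken by someone arriving at that same moment.
\<close>

definition bike_present ::
  "real \<Rightarrow> real \<Rightarrow> nat \<Rightarrow> (nat \<Rightarrow> nat \<Rightarrow> int) \<Rightarrow> (nat \<Rightarrow> nat \<Rightarrow> nat) \<Rightarrow> nat \<Rightarrow> nat \<Rightarrow> real \<Rightarrow> bool" where
  "bike_present v w n M ride b j t \<longleftrightarrow>
     (j = 0 \<or> (\<exists>i\<in>{1..n}. M i j = 1 \<and> ride i j = b \<and> arrival v w M i j \<le> t)) \<and>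
     (\<forall>i\<in>{1..n}. M i (Suc j) = 1 \<and> ride i (Suc j) = b \<longrightarrow> t \<le> arrival v w M i j)"

text \<open>
  Travel is only ever forward, so a bicycle traverses each stage at most once; that it carries
  a single rider is therefore injectivity of the plan on the riders of each stage.
\<close>

definition executable_without_waiting ::
  "real \<Rightarrow> real \<Rightarrow> nat \<Rightarrow> nat \<Rightarrow> (nat \<Rightarrow> nat \<Rightarrow> int) \<Rightarrow> bool" where
  "executable_without_waiting v w n k M \<longleftrightarrow>
     (\<exists>ride. \<forall>j<n.
        inj_on (\<lambda>i. ride i (Suc j)) {i\<in>{1..n}. M i (Suc j) = 1} \<and>
        (\<forall>i\<in>{1..n}. M i (Suc j) = 1 \<longrightarrow>
           ride i (Suc j) \<in> {1..k} \<and>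
           bike_present v w n M ride (ride i (Suc j)) j (arrival v w M i j)))"

definition optimal_matrix :: "real \<Rightarrow> real \<Rightarrow> nat \<Rightarrow> (nat \<Rightarrow> nat \<Rightarrow> int) \<Rightarrow> bool" where
  "optimal_matrix v w n M \<longleftrightarrow>
     (\<exists>k. uniform_matrix n k M \<and> executable_without_waiting v w n k M)"

end

theory Submission
  imports Defs
begin

text \<open>
  In a \<open>k\<close>-uniform scheme with \<open>k\<close> bicycles every bicycle is ridden on every stage. Hence the
  scheme runs without waiting iff at each intermediate post \<open>P\<^sub>j\<close> the riders of stage \<open>j + 1\<close>
  can be matched bijectively with riders of stage \<open>j\<close> who arrive at \<open>P\<^sub>j\<close> no later than they do.
  Permuting the travellers relabels these matchings. Reversing the stages replaces arrival times
  \<open>t\<close> by \<open>T - t\<close>, where the total time \<open>T\<close> is common to all travellers, so the inverse matchings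
  serve. Complementing replaces arrival times \<open>t\<close> at \<open>P\<^sub>j\<close> by \<open>j / v + j / w - t\<close>, and a matching
  of \<open>B\<close> with \<open>A\<close> induces one of \<open>X - B\<close> with \<open>X - A\<close> in the opposite direction.
\<close>

section \<open>Matchings at a post between those who bring a bicycle and those who take one\<close>

definition riders :: "nat \<Rightarrow> (nat \<Rightarrow> nat \<Rightarrow> int) \<Rightarrow> nat \<Rightarrow> nat set" where
  "riders n M j = {i\<in>{1..n}. M i j = 1}"

text \<open>Here \<open>t\<close> stands for arrival times at one fixed post, \<open>A\<close> for
  those who reach it by bicycle and \<open>B\<close> for those who leave it by bicycle;
  \<open>f i\<close> is the traveller whose bicycle \<open>i\<close> takes over.\<close>

definition handover :: "(nat \<Rightarrow> real) \<Rightarrow> nat set \<Rightarrow> nat set \<Rightarrow> bool" where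
  "handover t B A \<longleftrightarrow> (\<exists>f. bij_betw f B A \<and> (\<forall>i\<in>B. t (f i) \<le> t i))"

lemma finite_riders [simp]: "finite (riders n M j)"
  by (simp add: riders_def)

lemma card_riders: "uniform_matrix n k M \<Longrightarrow> j \<in> {1..n} \<Longrightarrow> card (riders n M j) = k"
  by (simp add: uniform_matrix_def riders_def)

text \<open>Reflecting time turns \<open>t (f i) \<le> t i\<close> round, which is what the inverse
  matching needs. The relation between \<open>s\<close> and \<open>t\<close> is asked only on
  \<open>A \<union> B\<close>, because the arrival formulas supply it only for indices of
  travellers.\<close>

lemma handover_reverse:
  assumes "handover t B A" and "\<And>i. i \<in> A \<union> B \<Longrightarrow> s i = c - t i"
  shows "handover s A B"
proof -
  obtain f where f: "bij_betw f B A" "\<And>i. i \<in> B \<Longrightarrow> t (f i) \<le> t i"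
    using assms(1) unfolding handover_def by blast
  let ?g = "inv_into B f"
  have g: "bij_betw ?g A B" by (rule bij_betw_inv_into[OF f(1)])
  have "s (?g i) \<le> s i" if "i \<in> A" for i
  proof -
    have "?g i \<in> B" using g that by (rule bij_betwE[rule_format])
    moreover have "f (?g i) = i" using f(1) that by (simp add: bij_betw_inv_into_right)
    ultimately show ?thesis using f(2)[of "?g i"] assms(2) that by auto
  qed
  with g show ?thesis unfolding handover_def by blast
qed

text \<open>Common elements are spliced out of the matching one at a time.\<close>

lemma handover_Diff:
  assumes "finite C" and "handover t B A" and "C = A \<inter> B"
  shows "handover t (B - A) (A - B)"
  using assms
proof (induction C arbitrary: A B rule: finite_induct)
  case empty
  then have "B - A = B" "A - B = A" by auto
  with empty show ?case by simp
next
  case (insert x C)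
  obtain f where f: "bij_betw f B A" "\<And>i. i \<in> B \<Longrightarrow> t (f i) \<le> t i"
    using insert.prems unfolding handover_def by blast
  have x: "x \<in> A" "x \<in> B" using insert.prems by auto
  obtain y where y: "y \<in> B" "f y = x" using f(1) x(1) by (auto simp: bij_betw_def)
  have inj: "inj_on f B" and im: "f ` B = A" using f(1) by (auto simp: bij_betw_def)
  \<comment> \<open>The taker \<open>y\<close> who was served by \<open>x\<close> is now served by
    the partner of \<open>x\<close>, so \<open>x\<close> drops out of both sides. If
    \<open>y = x\<close>, then \<open>g\<close> is just \<open>f\<close>.\<close>
  define g where "g = f(y := f x)"
  have "bij_betw g (B - {x}) (A - {x})"
  proof (cases "y = x")
    case True
    then have "g = f" using g_def by simp
    then show ?thesis using f(1) x y True
      by (metis bij_betw_DiffI bij_betw_singletonI empty_subsetI insert_subset)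
  next
    case False
    have "inj_on g (B - {x})"
      using inj x y False unfolding inj_on_def g_def by auto
    moreover have "g ` (B - {x}) = A - {x}"
    proof
      show "g ` (B - {x}) \<subseteq> A - {x}"
      proof
        fix a assume "a \<in> g ` (B - {x})"
        then obtain b where b: "b \<in> B" "b \<noteq> x" "a = g b" by blast
        show "a \<in> A - {x}"
        proof (cases "b = y")
          case True
          then have "a = f x" using b by (simp add: g_def)
          moreover have "f x \<noteq> f y" using inj x y False by (auto simp: inj_on_def)
          ultimately show ?thesis using im x y by auto
        next
          case False
          then have "a = f b" using b by (simp add: g_def)
          moreover have "f b \<noteq> f y" using inj b y False by (auto simp: inj_on_def)
          ultimately show ?thesis using im b y by auto
        qed
      qed
      show "A - {x} \<subseteq> g ` (B - {x})"
      proof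
        fix a assume a: "a \<in> A - {x}"
        then obtain b where b: "b \<in> B" "f b = a" using im by auto
        show "a \<in> g ` (B - {x})"
        proof (cases "b = x")
          case True
          then have "g y = a" using b by (simp add: g_def)
          then show ?thesis using y False by blast
        next
          case False
          then have "g b = a" using a b y by (auto simp: g_def)
          then show ?thesis using b False by blast
        qed
      qed
    qed
    ultimately show ?thesis by (simp add: bij_betw_def)
  qed
  \<comment> \<open>For \<open>i = y\<close> the chain is
    \<open>t (f x) \<le> t x = t (f y) \<le> t y\<close>.\<close>
  moreover have "t (g i) \<le> t i" if "i \<in> B - {x}" for i
    using f(2)[of i] f(2)[OF x(2)] f(2)[OF y(1)] y(2) that by (auto simp: g_def)
  ultimately have "handover t (B - {x}) (A - {x})"
    unfolding handover_def by blast
  moreover have "C = (A - {x}) \<inter> (B - {x})" using insert by auto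
  ultimately have "handover t (B - {x} - (A - {x})) (A - {x} - (B - {x}))"
    by (rule insert.IH)
  moreover have "B - {x} - (A - {x}) = B - A" "A - {x} - (B - {x}) = A - B" using x by auto
  ultimately show ?case by simp
qed

text \<open>Each member of \<open>D\<close> is matched with himself, at equal times.\<close>

lemma handover_Un_disjoint:
  assumes "handover t B A" and "D \<inter> A = {}" and "D \<inter> B = {}"
  shows "handover t (B \<union> D) (A \<union> D)"
proof -
  obtain f where f: "bij_betw f B A" "\<And>i. i \<in> B \<Longrightarrow> t (f i) \<le> t i"
    using assms(1) unfolding handover_def by blast
  let ?g = "\<lambda>i. if i \<in> B then f i else i"
  have "bij_betw ?g B A" using f(1) by (simp cong: bij_betw_cong)
  moreover have "bij_betw ?g D D"
    using assms(3) bij_betw_id[of D] by (subst bij_betw_cong[where g = id]) auto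
  ultimately have "bij_betw ?g (B \<union> D) (A \<union> D)"
    using assms(2) by (intro bij_betw_combine) auto
  moreover have "\<forall>i\<in>B \<union> D. t (?g i) \<le> t i" using f(2) by auto
  ultimately show ?thesis unfolding handover_def by blast
qed

text \<open>The part of \<open>X - A\<close> outside \<open>X - B\<close> is \<open>B - A\<close>,
  and the other way round it is \<open>A - B\<close>. So the matching left after cancelling
  \<open>A \<inter> B\<close> serves the complements too, once the elements outside both sets are
  added as fixed points.\<close>

lemma handover_complement:
  assumes "finite X" and "A \<subseteq> X" and "B \<subseteq> X" and "handover t B A"
  shows "handover t (X - A) (X - B)"
proof -
  have "finite (A \<inter> B)" using assms finite_subset by blast
  then have "handover t (B - A) (A - B)" using assms(4) handover_Diff by blast
  then have "handover t (B - A \<union> (X - (A \<union> B))) (A - B \<union> (X - (A \<union> B)))"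
    by (rule handover_Un_disjoint) auto
  moreover have "B - A \<union> (X - (A \<union> B)) = X - A" "A - B \<union> (X - (A \<union> B)) = X - B"
    using assms(2,3) by auto
  ultimately show ?thesis by simp
qed

section \<open>Execution without waiting in terms of matchings\<close>

text \<open>On each stage \<open>k\<close> riders hold distinct bicycles out of \<open>k\<close>, so
  all are in use, and sending a taker to the one who brought his bicycle is a bijection. Post 0 is
  excluded, as nobody brought the bicycles there.\<close>

lemma handover_if_executable:
  assumes unif: "uniform_matrix n k M" and exe: "executable_without_waiting v w n k M"
    and j: "0 < j" "j < n"
  shows "handover (\<lambda>i. arrival v w M i j) (riders n M (Suc j)) (riders n M j)"
proof -
  obtain ride where r: "\<forall>j<n.
      inj_on (\<lambda>i. ride i (Suc j)) {i\<in>{1..n}. M i (Suc j) = 1} \<and>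
      (\<forall>i\<in>{1..n}. M i (Suc j) = 1 \<longrightarrow> ride i (Suc j) \<in> {1..k} \<and>
        bike_present v w n M ride (ride i (Suc j)) j (arrival v w M i j))"
    using exe unfolding executable_without_waiting_def by blast
  have ride: "\<And>j. j < n \<Longrightarrow> inj_on (\<lambda>i. ride i (Suc j)) (riders n M (Suc j))"
      "\<And>j i. j < n \<Longrightarrow> i \<in> riders n M (Suc j) \<Longrightarrow> ride i (Suc j) \<in> {1..k}"
      "\<And>j i. j < n \<Longrightarrow> i \<in> riders n M (Suc j) \<Longrightarrow>
         bike_present v w n M ride (ride i (Suc j)) j (arrival v w M i j)"
    using r unfolding riders_def by blast+
  have bij: "bij_betw (\<lambda>i. ride i l) (riders n M l) {1..k}" if l: "l \<in> {1..n}" for l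
  proof -
    obtain m where m: "l = Suc m" "m < n" using l by (cases l) auto
    have sub: "(\<lambda>i. ride i l) ` riders n M l \<subseteq> {1..k}"
      using ride(2)[OF m(2)] m(1) by blast
    have inj: "inj_on (\<lambda>i. ride i l) (riders n M l)" using ride(1)[OF m(2)] m(1) by simp
    have "card ((\<lambda>i. ride i l) ` riders n M l) = card {1..k}"
      using card_image[OF inj] card_riders[OF unif l] by simp
    then show ?thesis using inj sub card_subset_eq[OF _ sub] by (simp add: bij_betw_def)
  qed
  let ?f = "inv_into (riders n M j) (\<lambda>i. ride i j) \<circ> (\<lambda>i. ride i (Suc j))"
  have bj: "bij_betw (\<lambda>i. ride i j) (riders n M j) {1..k}" using bij j by simp
  have "bij_betw ?f (riders n M (Suc j)) (riders n M j)"
    using j by (intro bij_betw_trans[OF bij bij_betw_inv_into[OF bj]]) auto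
  moreover have "arrival v w M (?f i) j \<le> arrival v w M i j" if i: "i \<in> riders n M (Suc j)" for i
  proof -
    \<comment> \<open>Since \<open>0 < j\<close>, presence of the bicycle means that some
      \<open>i'\<close> brought it in time; as a bicycle has one rider per stage, \<open>i'\<close>
      must be \<open>?f i\<close>.\<close>
    obtain i' where i': "i' \<in> riders n M j" "ride i' j = ride i (Suc j)"
      "arrival v w M i' j \<le> arrival v w M i j"
      using ride(3)[OF j(2) i] j(1) unfolding bike_present_def riders_def by auto
    have "?f i = i'"
      using bij_betw_inv_into_left[OF bj i'(1)] i'(2) by simp
    with i' show ?thesis by simp
  qed
  ultimately show ?thesis unfolding handover_def by blast
qed

text \<open>Bicycles are numbered arbitrarily on the first stage and then passed along the
  matchings. Bijectivity of the matchings keeps each number in use exactly once on every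
  stage.\<close>

lemma executable_if_handover:
  assumes unif: "uniform_matrix n k M"
    and ho: "\<And>j. 0 < j \<Longrightarrow> j < n \<Longrightarrow>
      handover (\<lambda>i. arrival v w M i j) (riders n M (Suc j)) (riders n M j)"
  shows "executable_without_waiting v w n k M"
\<comment> \<open>Without stages there is no first stage on which to number the bicycles.\<close>
proof (cases "n = 0")
  case True
  then show ?thesis by (simp add: executable_without_waiting_def)
next
  case False
  have "\<exists>f. 0 < j \<and> j < n \<longrightarrow> bij_betw f (riders n M (Suc j)) (riders n M j) \<and>
      (\<forall>i\<in>riders n M (Suc j). arrival v w M (f i) j \<le> arrival v w M i j)" for j
    using ho[of j] unfolding handover_def by blast
  then obtain F where F:
    "\<And>j. 0 < j \<Longrightarrow> j < n \<Longrightarrow> bij_betw (F j) (riders n M (Suc j)) (riders n M j)"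
    "\<And>j i. 0 < j \<Longrightarrow> j < n \<Longrightarrow> i \<in> riders n M (Suc j) \<Longrightarrow>
      arrival v w M (F j i) j \<le> arrival v w M i j"
    by metis
  obtain h where h: "bij_betw h (riders n M (Suc 0)) {1..k}"
    using card_riders[OF unif, of "Suc 0"] False finite_same_card_bij[of "riders n M (Suc 0)" "{1..k}"]
    by auto
  \<comment> \<open>\<open>R j\<close> is the assignment on stage \<open>Suc j\<close>: at post
    \<open>Suc j\<close> a rider of the following stage inherits the bicycle of his partner under
    \<open>F (Suc j)\<close>. The offset is undone by \<open>j - 1\<close> in
    \<open>ride\<close>.\<close>
  define R where "R = rec_nat h (\<lambda>j r i. r (F (Suc j) i))"
  have R0: "R 0 = h" and RS: "\<And>j i. R (Suc j) i = R j (F (Suc j) i)"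
    by (simp_all add: R_def)
  define ride where "ride = (\<lambda>i j. R (j - 1) i)"
  have bij: "bij_betw (R j) (riders n M (Suc j)) {1..k}" if "j < n" for j
    using that
  proof (induction j)
    case 0
    then show ?case using h R0 by simp
  next
    case (Suc j)
    have "bij_betw (R j \<circ> F (Suc j)) (riders n M (Suc (Suc j))) {1..k}"
      using Suc by (intro bij_betw_trans[OF F(1)]) auto
    moreover have "R j \<circ> F (Suc j) = R (Suc j)" by (simp add: fun_eq_iff RS)
    ultimately show ?case by simp
  qed
  have present: "bike_present v w n M ride (R j i) j (arrival v w M i j)"
    if j: "j < n" and i: "i \<in> riders n M (Suc j)" for i j
  proof -
    have giver: "\<exists>i'\<in>{1..n}. M i' j = 1 \<and> ride i' j = R j i \<and> arrival v w M i' j \<le> arrival v w M i j"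
      if pos: "j \<noteq> 0"
    proof -
      obtain m where m: "j = Suc m" using pos by (cases j) auto
      have "F j i \<in> riders n M j" using F(1)[of j] i j pos bij_betwE by blast
      moreover have "ride (F j i) j = R j i" by (simp add: m ride_def RS)
      moreover have "arrival v w M (F j i) j \<le> arrival v w M i j" using F(2) i j pos by simp
      ultimately show ?thesis unfolding riders_def by blast
    qed
    \<comment> \<open>Nobody can have taken the bicycle earlier, since \<open>i\<close> is its only
      rider on this stage.\<close>
    have "i' = i" if "i' \<in> riders n M (Suc j)" "R j i' = R j i" for i'
      using bij[OF j] that i by (auto simp: bij_betw_def inj_on_def)
    then have "\<forall>i'\<in>{1..n}. M i' (Suc j) = 1 \<and> ride i' (Suc j) = R j i \<longrightarrow>
        arrival v w M i j \<le> arrival v w M i' j"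
      by (fastforce simp: ride_def riders_def)
    with giver show ?thesis unfolding bike_present_def by blast
  qed
  have "inj_on (\<lambda>i. ride i (Suc j)) {i\<in>{1..n}. M i (Suc j) = 1} \<and>
      (\<forall>i\<in>{1..n}. M i (Suc j) = 1 \<longrightarrow> ride i (Suc j) \<in> {1..k} \<and>
        bike_present v w n M ride (ride i (Suc j)) j (arrival v w M i j))" if "j < n" for j
  proof -
    have rS: "ride i (Suc j) = R j i" for i by (simp add: ride_def)
    have "inj_on (R j) (riders n M (Suc j))" "\<forall>i\<in>riders n M (Suc j). R j i \<in> {1..k}"
      using bij[OF that] by (auto simp: bij_betw_def)
    then show ?thesis
      using present[OF that] unfolding rS riders_def by blast
  qed
  then show ?thesis unfolding executable_without_waiting_def by blast
qed

text \<open>This eliminates the plan, and \<open>k\<close> survives only in uniformity. Each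
  symmetry then reduces to a check of uniformity and a transport of matchings, one inner post at a
  time.\<close>

lemma optimal_matrix_iff_handover:
  "optimal_matrix v w n M \<longleftrightarrow> (\<exists>k. uniform_matrix n k M) \<and>
    (\<forall>j. 0 < j \<and> j < n \<longrightarrow>
      handover (\<lambda>i. arrival v w M i j) (riders n M (Suc j)) (riders n M j))"
  unfolding optimal_matrix_def
proof safe
  fix k j assume "uniform_matrix n k M" "executable_without_waiting v w n k M" "0 < j" "j < n"
  then show "handover (\<lambda>i. arrival v w M i j) (riders n M (Suc j)) (riders n M j)"
    by (rule handover_if_executable)
next
  fix k assume unif: "uniform_matrix n k M" and ho: "\<forall>j. 0 < j \<and> j < n \<longrightarrow>
      handover (\<lambda>i. arrival v w M i j) (riders n M (Suc j)) (riders n M j)"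
  have "executable_without_waiting v w n k M"
    by (rule executable_if_handover[OF unif]) (simp add: ho)
  with unif show "\<exists>k. uniform_matrix n k M \<and> executable_without_waiting v w n k M"
    by blast
qed blast

section \<open>Permuting the travellers\<close>

lemma optimal_matrix_permute_rows:
  assumes opt: "optimal_matrix v w n M" and p: "\<pi> permutes {1..n}"
  shows "optimal_matrix v w n (\<lambda>i j. M (\<pi> i) j)"
proof -
  let ?M = "\<lambda>i j. M (\<pi> i) j"
  obtain k where unif: "uniform_matrix n k M"
    using opt by (auto simp: optimal_matrix_def)
  have p_in: "\<pi> i \<in> {1..n} \<longleftrightarrow> i \<in> {1..n}" for i
    by (rule permutes_in_image[OF p])
  have bij: "bij_betw \<pi> (riders n ?M j) (riders n M j)" for j
  proof -
    have "inj_on \<pi> (riders n ?M j)" using permutes_inj[OF p] inj_on_subset by blast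
    moreover have "\<pi> ` riders n ?M j = riders n M j"
    proof
      show "\<pi> ` riders n ?M j \<subseteq> riders n M j" unfolding riders_def using p_in by blast
      show "riders n M j \<subseteq> \<pi> ` riders n ?M j"
      proof
        fix i assume i: "i \<in> riders n M j"
        obtain i' where "i = \<pi> i'" using permutes_surj[OF p] by (metis surjD)
        with i p_in[of i'] show "i \<in> \<pi> ` riders n ?M j" unfolding riders_def by blast
      qed
    qed
    ultimately show ?thesis by (simp add: bij_betw_def)
  qed
  have "uniform_matrix n k ?M"
    unfolding uniform_matrix_def binary_matrix_def
  proof (intro conjI ballI)
    fix j assume "j \<in> {1..n}"
    then show "card {i \<in> {1..n}. ?M i j = 1} = k"
      using bij_betw_same_card[OF bij[of j]] card_riders[OF unif] by (simp add: riders_def)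
  qed (use unif p_in in \<open>auto simp: uniform_matrix_def binary_matrix_def simp del: atLeastAtMost_iff\<close>)
  moreover have "handover (\<lambda>i. arrival v w ?M i j) (riders n ?M (Suc j)) (riders n ?M j)"
    if j: "0 < j" "j < n" for j
  proof -
    have "handover (\<lambda>i. arrival v w M i j) (riders n M (Suc j)) (riders n M j)"
      using opt j unfolding optimal_matrix_iff_handover by simp
    then obtain f where f: "bij_betw f (riders n M (Suc j)) (riders n M j)"
      "\<And>i. i \<in> riders n M (Suc j) \<Longrightarrow> arrival v w M (f i) j \<le> arrival v w M i j"
      unfolding handover_def by blast
    \<comment> \<open>The old matching conjugated by \<open>\<pi>\<close>: traveller
      \<open>i\<close> of the new scheme moves as \<open>\<pi> i\<close> does in the old
      one.\<close>
    let ?g = "inv_into (riders n ?M j) \<pi> \<circ> (f \<circ> \<pi>)"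
    have "bij_betw ?g (riders n ?M (Suc j)) (riders n ?M j)"
      by (intro bij_betw_trans[OF bij_betw_trans[OF bij f(1)] bij_betw_inv_into[OF bij]])
    moreover have "arrival v w ?M (?g i) j \<le> arrival v w ?M i j"
      if "i \<in> riders n ?M (Suc j)" for i
    proof -
      have i: "\<pi> i \<in> riders n M (Suc j)" using bij that bij_betwE by blast
      then have "f (\<pi> i) \<in> riders n M j" using f(1) bij_betwE by blast
      then have "\<pi> (?g i) = f (\<pi> i)" by (simp add: bij_betw_inv_into_right[OF bij])
      moreover have "arrival v w ?M l j = arrival v w M (\<pi> l) j" for l
        by (simp add: arrival_def)
      ultimately show ?thesis using f(2)[OF i] by simp
    qed
    ultimately show ?thesis unfolding handover_def by blast
  qed
  ultimately show ?thesis unfolding optimal_matrix_iff_handover by blast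
qed

section \<open>Reversing the stages\<close>

text \<open>Row uniformity makes the total time independent of the traveller; it supplies the
  constant \<open>c\<close> of \<open>handover_reverse\<close>.\<close>

lemma arrival_last:
  assumes "uniform_matrix n k M" and "i \<in> {1..n}"
  shows "arrival v w M i n = k / v + real (n - k) / w"
proof -
  let ?C = "{j\<in>{1..n}. M i j = 1}"
  have k: "card ?C = k" using assms by (simp add: uniform_matrix_def)
  have "{1..n} \<inter> {j. M i j = 1} = ?C" "{1..n} \<inter> - {j. M i j = 1} = {1..n} - ?C" by auto
  moreover have "card ({1..n} - ?C) = n - k"
    using card_Diff_subset[of ?C "{1..n}"] unfolding k by fastforce
  ultimately show ?thesis
    using k unfolding arrival_def by (simp only: sum.If_cases finite_atLeastAtMost sum_constant) simp
qed

text \<open>The first \<open>j\<close> stages of the reversed row are the last \<open>j\<close>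
  stages of the original row.\<close>

lemma arrival_reverse:
  assumes "j \<le> n"
  shows "arrival v w (\<lambda>i j. M i (n - j + 1)) i j = arrival v w M i n - arrival v w M i (n - j)"
  using assms
proof (induction j)
  case 0
  then show ?case by (simp add: arrival_def)
next
  case (Suc j)
  \<comment> \<open>Stage \<open>Suc j\<close> of the reversed row is stage \<open>Suc m\<close> of
    \<open>M\<close>, the last summand of the arrival time at post \<open>n - j\<close>.\<close>
  obtain m where m: "n - j = Suc m" "n - Suc j = m" using Suc.prems by (cases "n - j") auto
  show ?case using Suc m by (simp add: arrival_def)
qed

lemma optimal_matrix_reverse_stages:
  assumes opt: "optimal_matrix v w n M"
  shows "optimal_matrix v w n (\<lambda>i j. M i (n - j + 1))"
proof -
  let ?M = "\<lambda>i j. M i (n - j + 1)"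
  obtain k where unif: "uniform_matrix n k M"
    using opt by (auto simp: optimal_matrix_def)
  have "uniform_matrix n k ?M"
    unfolding uniform_matrix_def binary_matrix_def
  proof (intro conjI ballI)
    fix i assume i: "i \<in> {1..n}"
    have "bij_betw (\<lambda>j. n - j + 1) {j\<in>{1..n}. ?M i j = 1} {j\<in>{1..n}. M i j = 1}"
      by (rule bij_betw_byWitness[where f' = "\<lambda>j. n - j + 1"]) auto
    from bij_betw_same_card[OF this] show "card {j\<in>{1..n}. ?M i j = 1} = k"
      using unif i by (simp add: uniform_matrix_def)
  next
    fix j assume "j \<in> {1..n}"
    then have "n - j + 1 \<in> {1..n}" by auto
    then show "card {i \<in> {1..n}. ?M i j = 1} = k"
      using unif unfolding uniform_matrix_def by blast
  next
    fix i j assume i: "i \<in> {1..n}" and "j \<in> {1..n}"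
    then have "n - j + 1 \<in> {1..n}" by auto
    then show "?M i j \<in> {0, 1}"
      using unif i unfolding uniform_matrix_def binary_matrix_def by blast
  qed
  moreover have "handover (\<lambda>i. arrival v w ?M i j) (riders n ?M (Suc j)) (riders n ?M j)"
    if j: "0 < j" "j < n" for j
  proof -
    \<comment> \<open>Post \<open>j\<close> of the reversed scheme is the inner post
      \<open>?m\<close> of the original one, with bringers and takers interchanged.\<close>
    let ?m = "n - j"
    have "handover (\<lambda>i. arrival v w M i ?m) (riders n M (Suc ?m)) (riders n M ?m)"
      using opt j unfolding optimal_matrix_iff_handover by simp
    then have "handover (\<lambda>i. arrival v w ?M i j) (riders n M ?m) (riders n M (Suc ?m))"
    proof (rule handover_reverse)
      fix i assume "i \<in> riders n M ?m \<union> riders n M (Suc ?m)"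
      then have "i \<in> {1..n}" by (auto simp: riders_def)
      then show "arrival v w ?M i j = (k / v + real (n - k) / w) - arrival v w M i ?m"
        using arrival_reverse[of j n] arrival_last[OF unif] j by simp
    qed
    moreover have "riders n ?M (Suc j) = riders n M ?m" "riders n ?M j = riders n M (Suc ?m)"
      using j by (auto simp: riders_def Suc_diff_Suc)
    ultimately show ?thesis by simp
  qed
  ultimately show ?thesis unfolding optimal_matrix_iff_handover by blast
qed

section \<open>Exchanging cycling and walking\<close>

text \<open>Each stage is cycled in exactly one of the two schemes, so together they spend
  \<open>1 / v + 1 / w\<close> on it. Binary entries matter here: any other value would count as
  walking in both.\<close>

lemma arrival_complement:
  assumes "binary_matrix n M" and "i \<in> {1..n}" and "j \<le> n"
  shows "arrival v w (\<lambda>i j. 1 - M i j) i j = (j / v + j / w) - arrival v w M i j"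
  using assms(3)
proof (induction j)
  case 0
  then show ?case by (simp add: arrival_def)
next
  case (Suc j)
  then have "Suc j \<in> {1..n}" by simp
  then have "M i (Suc j) = 0 \<or> M i (Suc j) = 1"
    using assms(1,2) unfolding binary_matrix_def by blast
  then show ?case using Suc by (auto simp: arrival_def add_divide_distrib)
qed

lemma optimal_matrix_complement:
  assumes opt: "optimal_matrix v w n M"
  shows "optimal_matrix v w n (\<lambda>i j. 1 - M i j)"
proof -
  let ?M = "\<lambda>i j. 1 - M i j"
  obtain k where unif: "uniform_matrix n k M"
    using opt by (auto simp: optimal_matrix_def)
  then have bin: "binary_matrix n M" by (simp add: uniform_matrix_def)
  have M01: "?M i j = 1 \<longleftrightarrow> M i j \<noteq> 1" if "i \<in> {1..n}" "j \<in> {1..n}" for i j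
    using bin that unfolding binary_matrix_def by fastforce
  have riders_compl: "riders n ?M j = {1..n} - riders n M j" if "j \<in> {1..n}" for j
    using M01 that unfolding riders_def by blast
  have "uniform_matrix n (n - k) ?M"
    unfolding uniform_matrix_def binary_matrix_def
  proof (intro conjI ballI)
    fix i assume i: "i \<in> {1..n}"
    have "{j \<in> {1..n}. ?M i j = 1} = {1..n} - {j \<in> {1..n}. M i j = 1}"
      using M01 i by blast
    moreover have "card {j \<in> {1..n}. M i j = 1} = k"
      using unif i unfolding uniform_matrix_def by blast
    ultimately show "card {j \<in> {1..n}. ?M i j = 1} = n - k"
      using card_Diff_subset[of "{j \<in> {1..n}. M i j = 1}" "{1..n}"] by fastforce
  next
    fix j assume j: "j \<in> {1..n}"
    have "riders n M j \<subseteq> {1..n}" by (auto simp: riders_def)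
    then have "card (riders n ?M j) = n - k"
      using card_riders[OF unif j] by (simp add: riders_compl[OF j] card_Diff_subset)
    then show "card {i \<in> {1..n}. ?M i j = 1} = n - k" by (simp add: riders_def)
  next
    fix i j assume "i \<in> {1..n}" "j \<in> {1..n}"
    then show "?M i j \<in> {0, 1}" using bin unfolding binary_matrix_def by fastforce
  qed
  moreover have "handover (\<lambda>i. arrival v w ?M i j) (riders n ?M (Suc j)) (riders n ?M j)"
    if j: "0 < j" "j < n" for j
  proof -
    have "handover (\<lambda>i. arrival v w M i j) (riders n M (Suc j)) (riders n M j)"
      using opt j unfolding optimal_matrix_iff_handover by simp
    \<comment> \<open>The direction is reversed twice: first by passing to complements with the old
      times, then by reflecting the times. So the takers of the new scheme end up on the correct
      side.\<close>
    then have "handover (\<lambda>i. arrival v w M i j) ({1..n} - riders n M j) ({1..n} - riders n M (Suc j))"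
      by (intro handover_complement) (auto simp: riders_def)
    then have "handover (\<lambda>i. arrival v w ?M i j)
        ({1..n} - riders n M (Suc j)) ({1..n} - riders n M j)"
      by (rule handover_reverse[where c = "j / v + j / w"])
        (use arrival_complement[OF bin] j in auto)
    then show ?thesis using j by (simp add: riders_compl)
  qed
  ultimately show ?thesis unfolding optimal_matrix_iff_handover by blast
qed

theorem theorem3p14:
  fixes v w :: real and n :: nat and M :: "nat \<Rightarrow> nat \<Rightarrow> int"
  assumes "0 < w" and "w < v"
    and "optimal_matrix v w n M"
  shows "(\<forall>\<pi>. \<pi> permutes {1..n} \<longrightarrow> optimal_matrix v w n (\<lambda>i j. M (\<pi> i) j)) \<and>
         optimal_matrix v w n (\<lambda>i j. M i (n - j + 1)) \<and>
         optimal_matrix v w n (\<lambda>i j. 1 - M i j)"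
  by (intro conjI allI impI optimal_matrix_permute_rows[OF assms(3)]
      optimal_matrix_reverse_stages[OF assms(3)] optimal_matrix_complement[OF assms(3)])

end
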